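(* Let $f$ be a fixed probability density function on $\mathbb{R}$ satisfying $f(0)>0$, and for $\theta=(\mu,\sigma)\in\Theta:=\mathbb{R}\times(0,\infty)$ let $f_\theta(x)=\frac{1}{\sigma}f\left(\frac{x-\mu}{\sigma}\right)$. Let $X_1,X_2,\ldots,X_n$ be independent and identically distributed observations from a density $g$, which is modeled by the densities in the location-scale family $\{f_\theta:\theta\in\Theta\}$. Then, for any $0\le\lambda<1$ and $\alpha>0$, with $\bar\lambda=1-\lambda$, $$\inf_{\theta\in\Theta}\left[\log\left(\lambda+\bar\lambda\int f_\theta^{1+\alpha}(x)\,dx\right)-\left(\frac{1+\alpha}{\alpha}\right)\log\left(\lambda+\frac{\bar\lambda}{n}\sum_{i=1}^n f_\theta^{\alpha}(X_i)\right)\right]=-\infty .$$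
   Context: The bracketed expression is (up to the positive factor $1/\bar\lambda$ and an additive term not depending on $\theta$) the sample version of the bridge density power divergence with parameters $(\alpha,\lambda)$ for the location-scale model family $\{f_\theta:\theta\in\Theta\}$. That the data are "modeled by" this family means only that the objective function is formed with the densities $f_\theta$; $g$ need not belong to the family. Notation: $f_\theta^{\alpha}(x)=(f_\theta(x))^{\alpha}$.
   Formalization: The formal statement adds the assumption that the integral of f^(1+α) is finite; if it is infinite (e.g. α=1, f(x)=1/(2√x) on (0,1), f(0)=1), the bracket is +∞ for every θ and the claim fails. *)

theory Defs
  imports "HOL-Probability.Probability"
begin

definition prob_density :: "(real \<Rightarrow> real) \<Rightarrow> bool" where
  "prob_density f \<longleftrightarrow>
     f \<in> borel_measurable borel \<and> (\<forall>x. 0 \<le> f x) \<and> (\<integral>\<^sup>+x. ennreal (f x) \<partial>lborel) = 1"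

definition loc_scale_params :: "(real \<times> real) set" where
  "loc_scale_params = UNIV \<times> {0<..}"

definition loc_scale :: "(real \<Rightarrow> real) \<Rightarrow> real \<times> real \<Rightarrow> real \<Rightarrow> real" where
  "loc_scale f = (\<lambda>(\<mu>, \<sigma>) x. 1 / \<sigma> * f ((x - \<mu>) / \<sigma>))"

(* The logarithm as a map from [0, \<infinity>] to [-\<infinity>, \<infinity>].  The real function ln has ln 0 = 0,
   which would be wrong below: for lam = 0 a density with bounded support may vanish at all
   observations, and the objective is then +\<infinity>. *)
definition xln :: "ennreal \<Rightarrow> ereal" where
  "xln x = (if x = 0 then -\<infinity> else if x = \<infinity> then \<infinity> else ereal (ln (enn2real x)))"

(* The weight lam is the lambda of the divergence; x 1, ..., x n are the observations.  If f is a
   probability density for which the integral of f powr (1 + \<alpha>) is finite and 0 <= lam < 1, then the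
   first logarithm is finite for every parameter, so the difference is never \<infinity> - \<infinity>.  If that
   integral is infinite, the objective is \<infinity> for every parameter. *)
definition bridge_objective ::
  "(real \<Rightarrow> real) \<Rightarrow> real \<Rightarrow> real \<Rightarrow> nat \<Rightarrow> (nat \<Rightarrow> real) \<Rightarrow> real \<times> real \<Rightarrow> ereal" where
  "bridge_objective f \<alpha> lam n x \<theta> =
     xln (ennreal lam + ennreal (1 - lam) * (\<integral>\<^sup>+t. ennreal (loc_scale f \<theta> t powr (1 + \<alpha>)) \<partial>lborel))
     - ereal ((1 + \<alpha>) / \<alpha>) *
       xln (ennreal (lam + (1 - lam) / real n * (\<Sum>i=1..n. loc_scale f \<theta> (x i) powr \<alpha>)))"

end

theory Submission
  imports Defs
begin

text \<open>Put the location at the first observation and let the scale tend to 0. With s = \<sigma> powr -\<alpha>,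
  the integral equals s times the integral of f powr (1 + \<alpha>), and the empirical sum is at least
  s * f 0 powr \<alpha>. Hence, up to additive constants, the objective is at most
  ln s - (1 + \<alpha>) / \<alpha> * ln s = ln \<sigma>.\<close>

lemma xln_mono: "xln x \<le> xln y" if "x \<le> y"
  using that
  by (cases x; cases y)
     (auto simp: xln_def ennreal_zero_less_top top_unique ennreal_eq_0_iff)

lemma xln_ennreal: "0 < r \<Longrightarrow> xln (ennreal r) = ereal (ln r)"
  by (auto simp: xln_def ennreal_eq_0_iff)

text \<open>The substitution t = \<mu> + \<sigma> * x gives a Jacobian \<sigma>, and the prefactor 1
  / \<sigma> of the density gives \<open>\<sigma> powr -(1 + \<alpha>)\<close>; their product is
  \<open>\<sigma> powr -\<alpha>\<close>. Working in \<open>ennreal\<close>, this also covers an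
  infinite integral.\<close>

lemma nn_integral_loc_scale_powr:
  fixes \<sigma> \<mu> \<alpha> :: real
  assumes [measurable]: "f \<in> borel_measurable borel" and nonneg: "\<And>x. 0 \<le> f x" and "\<sigma> > 0"
  shows "(\<integral>\<^sup>+t. ennreal (loc_scale f (\<mu>, \<sigma>) t powr (1 + \<alpha>)) \<partial>lborel) =
    ennreal (\<sigma> powr -\<alpha>) * (\<integral>\<^sup>+x. ennreal (f x powr (1 + \<alpha>)) \<partial>lborel)"
proof -
  have scaled: "loc_scale f (\<mu>, \<sigma>) (\<mu> + \<sigma> * x) powr (1 + \<alpha>) =
      \<sigma> powr -(1 + \<alpha>) * f x powr (1 + \<alpha>)" for x
    using \<open>\<sigma> > 0\<close> nonneg unfolding powr_minus_divide by (simp add: loc_scale_def powr_divide)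
  have "(\<integral>\<^sup>+t. ennreal (loc_scale f (\<mu>, \<sigma>) t powr (1 + \<alpha>)) \<partial>lborel) =
      ennreal \<sigma> * (\<integral>\<^sup>+x. ennreal (loc_scale f (\<mu>, \<sigma>) (\<mu> + \<sigma> * x) powr (1 + \<alpha>)) \<partial>lborel)"
    using \<open>\<sigma> > 0\<close> by (subst nn_integral_real_affine[where c = \<sigma> and t = \<mu>]) (auto simp: loc_scale_def)
  also have "(\<integral>\<^sup>+x. ennreal (loc_scale f (\<mu>, \<sigma>) (\<mu> + \<sigma> * x) powr (1 + \<alpha>)) \<partial>lborel) =
      ennreal (\<sigma> powr -(1 + \<alpha>)) * (\<integral>\<^sup>+x. ennreal (f x powr (1 + \<alpha>)) \<partial>lborel)"
    unfolding scaled by (simp add: ennreal_mult nn_integral_cmult)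
  also have "ennreal \<sigma> * (ennreal (\<sigma> powr -(1 + \<alpha>)) * (\<integral>\<^sup>+x. ennreal (f x powr (1 + \<alpha>)) \<partial>lborel)) =
      ennreal (\<sigma> * \<sigma> powr -(1 + \<alpha>)) * (\<integral>\<^sup>+x. ennreal (f x powr (1 + \<alpha>)) \<partial>lborel)"
    using \<open>\<sigma> > 0\<close> by (simp add: ennreal_mult mult.assoc)
  also have "\<sigma> * \<sigma> powr -(1 + \<alpha>) = \<sigma> powr -\<alpha>"
    using \<open>\<sigma> > 0\<close> powr_add[of \<sigma> 1 "-(1 + \<alpha>)"] by simp
  finally show ?thesis .
qed

text \<open>The constant may depend on the sample size and on all parameters except \<sigma>, which
  is what lets \<sigma> tend to 0 afterwards.\<close>

lemma bridge_objective_le_ln_scale: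
  assumes f: "prob_density f" and "f 0 > 0" and "n \<ge> 1" and lam: "0 \<le> lam" "lam < 1" and "\<alpha> > 0"
    and fin: "(\<integral>\<^sup>+x. ennreal (f x powr (1 + \<alpha>)) \<partial>lborel) < \<infinity>"
  shows "\<exists>C. \<forall>\<sigma>\<in>{0<..1}. bridge_objective f \<alpha> lam n x (x 1, \<sigma>) \<le> ereal (ln \<sigma> + C)"
proof -
  from f have meas: "f \<in> borel_measurable borel" and nonneg: "\<And>x. 0 \<le> f x"
    by (auto simp: prob_density_def)
  define I where "I = enn2real (\<integral>\<^sup>+x. ennreal (f x powr (1 + \<alpha>)) \<partial>lborel)"
  \<comment> \<open>\<open>s * B\<close> will be the contribution of the first observation alone to
    the empirical term. It is positive because f 0 > 0 and lam < 1, so its logarithm is finite even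
    for lam = 0.\<close>
  define B where "B = (1 - lam) / real n * f 0 powr \<alpha>"
  have I: "(\<integral>\<^sup>+x. ennreal (f x powr (1 + \<alpha>)) \<partial>lborel) = ennreal I" "0 \<le> I"
    using fin by (simp_all add: I_def)
  have "0 < B"
    using assms by (simp add: B_def)
  have "bridge_objective f \<alpha> lam n x (x 1, \<sigma>)
      \<le> ereal (ln \<sigma> + (ln (1 + I) - (1 + \<alpha>) / \<alpha> * ln B))" if \<sigma>: "\<sigma> \<in> {0<..1}" for \<sigma>
  proof -
    define s where "s = \<sigma> powr -\<alpha>"
    have "0 < \<sigma>" "\<sigma> \<le> 1" using \<sigma> by auto
    have "0 < s" using \<open>0 < \<sigma>\<close> by (simp add: s_def)
    have "1 \<le> s"
      using \<open>0 < \<sigma>\<close> \<open>\<sigma> \<le> 1\<close> \<open>\<alpha> > 0\<close> by (simp add: s_def powr_minus powr_le1 one_le_inverse)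
    have ln_s: "ln s = - \<alpha> * ln \<sigma>"
      using \<open>0 < \<sigma>\<close> by (simp add: s_def ln_powr)
    \<comment> \<open>Since lam < 1 and 1 \<le> s, the summand lam is absorbed into s; this is where
      \<sigma> \<le> 1 enters. The resulting product has a logarithm that splits, and 1 + I is
      positive without any lower bound on I beyond 0.\<close>
    have "lam + (1 - lam) * (s * I) \<le> s * (1 + I)"
    proof -
      have "(1 - lam) * (s * I) \<le> 1 * (s * I)"
        using lam I \<open>0 < s\<close> by (intro mult_right_mono) auto
      then show ?thesis
        using lam \<open>1 \<le> s\<close> unfolding distrib_left by linarith
    qed
    then have "xln (ennreal lam + ennreal (1 - lam) *
        (\<integral>\<^sup>+t. ennreal (loc_scale f (x 1, \<sigma>) t powr (1 + \<alpha>)) \<partial>lborel)) \<le> xln (ennreal (s * (1 + I)))"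
      unfolding nn_integral_loc_scale_powr[OF meas nonneg \<open>0 < \<sigma>\<close>] I(1) s_def[symmetric]
      using lam I(2) \<open>0 < s\<close>
      by (intro xln_mono) (simp flip: ennreal_mult ennreal_plus)
    also have "\<dots> = ereal (ln s + ln (1 + I))"
      using \<open>0 < s\<close> I(2) by (simp add: xln_ennreal ln_mult)
    finally have upper: "xln (ennreal lam + ennreal (1 - lam) *
        (\<integral>\<^sup>+t. ennreal (loc_scale f (x 1, \<sigma>) t powr (1 + \<alpha>)) \<partial>lborel)) \<le> ereal (ln s + ln (1 + I))" .
    \<comment> \<open>At the location \<open>x 1\<close> the standardized first observation is 0 for
      every \<sigma>, so its summand is known exactly; the other summands are only used to be
      nonnegative.\<close>
    have "s * f 0 powr \<alpha> = loc_scale f (x 1, \<sigma>) (x 1) powr \<alpha>"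
      using \<open>0 < \<sigma>\<close> nonneg by (simp add: s_def loc_scale_def powr_divide powr_minus_divide)
    also have "\<dots> \<le> (\<Sum>i=1..n. loc_scale f (x 1, \<sigma>) (x i) powr \<alpha>)"
      using \<open>n \<ge> 1\<close> by (intro member_le_sum) auto
    finally have "(1 - lam) / real n * (s * f 0 powr \<alpha>)
        \<le> (1 - lam) / real n * (\<Sum>i=1..n. loc_scale f (x 1, \<sigma>) (x i) powr \<alpha>)"
      using lam by (intro mult_left_mono) auto
    then have "s * B \<le> lam + (1 - lam) / real n * (\<Sum>i=1..n. loc_scale f (x 1, \<sigma>) (x i) powr \<alpha>)"
      using lam by (simp add: B_def mult_ac)
    then have "xln (ennreal (s * B))
        \<le> xln (ennreal (lam + (1 - lam) / real n * (\<Sum>i=1..n. loc_scale f (x 1, \<sigma>) (x i) powr \<alpha>)))"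
      by (intro xln_mono ennreal_leI)
    then have lower: "ereal (ln s + ln B)
        \<le> xln (ennreal (lam + (1 - lam) / real n * (\<Sum>i=1..n. loc_scale f (x 1, \<sigma>) (x i) powr \<alpha>)))"
      using \<open>0 < s\<close> \<open>0 < B\<close> by (simp add: xln_ennreal ln_mult)
    have "bridge_objective f \<alpha> lam n x (x 1, \<sigma>)
        \<le> ereal (ln s + ln (1 + I)) - ereal ((1 + \<alpha>) / \<alpha>) * ereal (ln s + ln B)"
      unfolding bridge_objective_def using \<open>\<alpha> > 0\<close>
      by (intro ereal_minus_mono upper ereal_mult_left_mono lower) auto
    \<comment> \<open>The coefficient of ln s is 1 - (1 + \<alpha>) / \<alpha> = -1 / \<alpha>, and
      ln s = -\<alpha> * ln \<sigma>.\<close>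
    also have "\<dots> = ereal (ln \<sigma> + (ln (1 + I) - (1 + \<alpha>) / \<alpha> * ln B))"
      using \<open>\<alpha> > 0\<close> by (simp add: ln_s field_simps)
    finally show ?thesis .
  qed
  then show ?thesis by blast
qed

text \<open>The bound holds for each fixed sample, so the conclusion is stated for every \<omega>
  and not just almost surely. The integral of \<open>f powr (1 + \<alpha>)\<close> is assumed finite
  because otherwise the objective is \<infinity> at every parameter.\<close>

theorem theorem5p1:
  fixes f g :: "real \<Rightarrow> real"
    and M :: "'a measure"
    and X :: "nat \<Rightarrow> 'a \<Rightarrow> real"
    and n :: nat
    and \<alpha> lam :: real
  assumes "prob_density f" and "f 0 > 0"
    and "prob_density g"
    and "prob_space M"
    and "n \<ge> 1"
    and "prob_space.indep_vars M (\<lambda>_. borel) X {1..n}"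
    and "\<And>i. i \<in> {1..n} \<Longrightarrow> distributed M lborel (X i) (\<lambda>x. ennreal (g x))"
    and "0 \<le> lam" and "lam < 1" and "\<alpha> > 0"
    and "(\<integral>\<^sup>+x. ennreal (f x powr (1 + \<alpha>)) \<partial>lborel) < \<infinity>"
  shows "\<forall>\<omega>\<in>space M.
    (INF \<theta>\<in>loc_scale_params. bridge_objective f \<alpha> lam n (\<lambda>i. X i \<omega>) \<theta>) = -\<infinity>"
proof
  fix \<omega>
  let ?J = "bridge_objective f \<alpha> lam n (\<lambda>i. X i \<omega>)"
  obtain C where C: "\<And>\<sigma>. \<sigma> \<in> {0<..1} \<Longrightarrow> ?J (X 1 \<omega>, \<sigma>) \<le> ereal (ln \<sigma> + C)"
    using bridge_objective_le_ln_scale[of f n lam \<alpha> "\<lambda>i. X i \<omega>"] assms by blast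
  show "(INF \<theta>\<in>loc_scale_params. ?J \<theta>) = -\<infinity>"
  proof (rule ereal_bot)
    fix b :: real
    \<comment> \<open>ln \<sigma> is chosen at most b - C to bring the bound below b, and at most 0
      to keep \<sigma> \<le> 1.\<close>
    define \<sigma> where "\<sigma> = exp (min 0 (b - C))"
    have \<sigma>: "\<sigma> \<in> {0<..1}" by (simp add: \<sigma>_def)
    then have "(INF \<theta>\<in>loc_scale_params. ?J \<theta>) \<le> ?J (X 1 \<omega>, \<sigma>)"
      by (intro INF_lower) (simp add: loc_scale_params_def)
    also have "\<dots> \<le> ereal (ln \<sigma> + C)" using C[OF \<sigma>] .
    also have "\<dots> \<le> ereal b" by (simp add: \<sigma>_def)
    finally show "(INF \<theta>\<in>loc_scale_params. ?J \<theta>) \<le> ereal b" .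
  qed
qed

end
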